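(* Let $n\ge1$ and let $\mathcal{F}$ be a family of probability distributions on $\{0,1\}^n$ such that, for every $P\in\mathcal{F}$, the number of positive outcomes $n_1(Y)=\sum_{i=1}^nY_i$ is $P$-almost surely constant, where $Y=(Y_1,\dots,Y_n)\sim P$. Then $\mathrm{AUC}$ is a strictly $R^*$-proper scoring function for $\mathcal{F}$.
   Context: $\Xi_n$ is the set of total preorders on $\{1,\dots,n\}$; for $\precsim\,\in\Xi_n$, $i\succsim j$ means $j\precsim i$. The rank vector is $\rho_i(\precsim)=\sum_{j=1}^n\left(\mathbf 1_{j\precsim i}-\mathbf 1_{j\succsim i}\right)$. For $y\in\{0,1\}^n$ let $n_1(y)=\sum_i y_i$, $n_0(y)=n-n_1(y)$, and let $\alpha_i(y)=\dfrac{y_i}{n_0(y)n_1(y)}$ if $n_1(y)\notin\{0,n\}$ and $\alpha_i(y)=0$ otherwise. The empirical area under the curve is $$\mathrm{AUC}(y,\precsim)=\tfrac12+\tfrac12\sum_{i=1}^n\alpha_i(y)\rho_i(\precsim).$$ For a distribution $P$ on $\{0,1\}^n$, $R(P)$ is the total preorder given by $i\precsim j\Leftrightarrow P[Y_i=1]\le P[Y_j=1]$, and $R^*(P)$ is the set of all $\precsim\,\in\Xi_n$ contained in $R(P)$ (i.e. $i\precsim j$ implies that $(i,j)\in R(P)$). A function $s:\{0,1\}^n\times\Xi_n\to\mathbb{R}$ is strictly $R^*$-proper for $\mathcal{F}$ if for all $P\in\mathcal{F}$, all $u\in\Xi_n$ and all $t\in R^*(P)$, $\mathbb{E}_P[s(Y,u)]\le\mathbb{E}_P[s(Y,t)]$,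 with equality only if $u\in R^*(P)$. *)

theory Defs
  imports "HOL-Probability.Probability_Mass_Function"
begin

(* A relation r encodes a preorder by: (i, j) \<in> r iff i \<precsim> j. *)

definition total_preorders :: "nat \<Rightarrow> (nat \<times> nat) set set" where
  "total_preorders n = {r. preorder_on {1..n} r \<and> total_on {1..n} r}"

definition rank_vec :: "nat \<Rightarrow> (nat \<times> nat) set \<Rightarrow> nat \<Rightarrow> real" where
  "rank_vec n r i = (\<Sum>j=1..n. of_bool ((j, i) \<in> r) - of_bool ((i, j) \<in> r))"

definition outcomes :: "nat \<Rightarrow> (nat \<Rightarrow> nat) set" where
  "outcomes n = {1..n} \<rightarrow>\<^sub>E {0, 1}"

(* Since {0,1}^n is finite, its probability distributions are the mass functions
   supported on it. *)
definition outcome_distributions :: "nat \<Rightarrow> (nat \<Rightarrow> nat) pmf set" where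
  "outcome_distributions n = {P. set_pmf P \<subseteq> outcomes n}"

definition n1 :: "nat \<Rightarrow> (nat \<Rightarrow> nat) \<Rightarrow> nat" where
  "n1 n y = (\<Sum>i=1..n. y i)"

(* The natural-number subtraction does not truncate for y in outcomes n. *)
definition n0 :: "nat \<Rightarrow> (nat \<Rightarrow> nat) \<Rightarrow> nat" where
  "n0 n y = n - n1 n y"

definition auc_weight :: "nat \<Rightarrow> (nat \<Rightarrow> nat) \<Rightarrow> nat \<Rightarrow> real" where
  "auc_weight n y i =
     (if n1 n y \<notin> {0, n} then real (y i) / (real (n0 n y) * real (n1 n y)) else 0)"

definition AUC :: "nat \<Rightarrow> (nat \<Rightarrow> nat) \<Rightarrow> (nat \<times> nat) set \<Rightarrow> real" where
  "AUC n y r = 1/2 + 1/2 * (\<Sum>i=1..n. auc_weight n y i * rank_vec n r i)"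

definition R_order :: "nat \<Rightarrow> (nat \<Rightarrow> nat) pmf \<Rightarrow> (nat \<times> nat) set" where
  "R_order n P = {(i, j). i \<in> {1..n} \<and> j \<in> {1..n} \<and>
     measure_pmf.prob P {y. y i = 1} \<le> measure_pmf.prob P {y. y j = 1}}"

definition R_star :: "nat \<Rightarrow> (nat \<Rightarrow> nat) pmf \<Rightarrow> (nat \<times> nat) set set" where
  "R_star n P = {r \<in> total_preorders n. r \<subseteq> R_order n P}"

definition strictly_R_star_proper ::
    "nat \<Rightarrow> ((nat \<Rightarrow> nat) \<Rightarrow> (nat \<times> nat) set \<Rightarrow> real) \<Rightarrow> (nat \<Rightarrow> nat) pmf set \<Rightarrow> bool" where
  "strictly_R_star_proper n s F \<longleftrightarrow>
     (\<forall>P\<in>F. \<forall>u\<in>total_preorders n. \<forall>t\<in>R_star n P.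
        measure_pmf.expectation P (\<lambda>y. s y u) \<le> measure_pmf.expectation P (\<lambda>y. s y t) \<and>
        (measure_pmf.expectation P (\<lambda>y. s y u) = measure_pmf.expectation P (\<lambda>y. s y t)
           \<longrightarrow> u \<in> R_star n P))"

end

theory Submission
  imports Defs
begin

text \<open>
  When \<open>n\<^sub>1 = k\<close> almost surely, the weights are \<open>c y\<^sub>i\<close> for a constant \<open>c\<close>, so the expected AUC is
  \<open>1/2 + c/2 \<Sum>\<^sub>i p\<^sub>i \<rho>\<^sub>i\<close> with \<open>p\<^sub>i = P[Y\<^sub>i = 1]\<close>. As \<open>\<rho>\<close> is a sum of an antisymmetric array,
  symmetrising gives \<open>2 \<Sum>\<^sub>i p\<^sub>i \<rho>\<^sub>i = \<Sum>\<^sub>i\<^sub>j (p\<^sub>i - p\<^sub>j) (1[j \<precsim> i] - 1[i \<precsim> j])\<close>, and every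
  summand is at most \<open>\<bar>p\<^sub>i - p\<^sub>j\<bar>\<close>. All these bounds are attained exactly when no \<open>i \<precsim> j\<close> has
  \<open>p\<^sub>i > p\<^sub>j\<close>. If \<open>c = 0\<close>, that is \<open>k \<in> {0, n}\<close>, then all \<open>p\<^sub>i\<close> coincide and every total preorder
  lies in \<open>R\<^sup>*(P)\<close>.
\<close>

text \<open>\<open>total_on\<close> compares distinct points only; the case \<open>i = j\<close> of
  the second claim comes from reflexivity.\<close>

lemma total_preordersD:
  assumes "r \<in> total_preorders n"
  shows "r \<subseteq> {1..n} \<times> {1..n}"
    and "\<lbrakk>i \<in> {1..n}; j \<in> {1..n}\<rbrakk> \<Longrightarrow> (i, j) \<in> r \<or> (j, i) \<in> r"
  using assms
  unfolding total_preorders_def preorder_on_def total_on_def refl_on_def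
  by auto (metis atLeastAtMost_iff)

lemma sum_rank_vec_symmetrised:
  fixes p :: "nat \<Rightarrow> real"
  shows "2 * (\<Sum>i=1..n. p i * rank_vec n r i) =
    (\<Sum>i=1..n. \<Sum>j=1..n. (p i - p j) * (of_bool ((j, i) \<in> r) - of_bool ((i, j) \<in> r)))"
proof -
  define d :: "nat \<Rightarrow> nat \<Rightarrow> real"
    where "d i j = of_bool ((j, i) \<in> r) - of_bool ((i, j) \<in> r)" for i j
  \<comment> \<open>Swapping the names of the two indices turns \<open>d i j\<close> into
    \<open>d j i\<close>, which is \<open>- d i j\<close>.\<close>
  have "(\<Sum>i=1..n. \<Sum>j=1..n. p j * d i j) = (\<Sum>i=1..n. \<Sum>j=1..n. p i * d j i)"
    by (rule sum.swap)
  also have "\<dots> = - (\<Sum>i=1..n. \<Sum>j=1..n. p i * d i j)"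
    by (simp add: d_def flip: sum_negf) (simp add: algebra_simps)
  finally have "(\<Sum>i=1..n. \<Sum>j=1..n. (p i - p j) * d i j)
      = 2 * (\<Sum>i=1..n. \<Sum>j=1..n. p i * d i j)"
    by (simp add: left_diff_distrib sum_subtractf)
  then show ?thesis
    by (simp add: d_def rank_vec_def sum_distrib_left)
qed

text \<open>The difference of indicators lies in {-1, 0, 1}. The resulting bound does not depend on
  \<open>r\<close>, so it serves as a common maximum for all preorders.\<close>

lemma sum_rank_vec_le:
  fixes p :: "nat \<Rightarrow> real"
  shows "2 * (\<Sum>i=1..n. p i * rank_vec n r i) \<le> (\<Sum>i=1..n. \<Sum>j=1..n. \<bar>p i - p j\<bar>)"
  unfolding sum_rank_vec_symmetrised by (intro sum_mono) auto

lemma sum_rank_vec_eq_iff: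
  fixes p :: "nat \<Rightarrow> real"
  assumes r: "r \<in> total_preorders n"
  shows "2 * (\<Sum>i=1..n. p i * rank_vec n r i) = (\<Sum>i=1..n. \<Sum>j=1..n. \<bar>p i - p j\<bar>)
    \<longleftrightarrow> (\<forall>(i, j)\<in>r. p i \<le> p j)"
    (is "?L = ?R \<longleftrightarrow> _")
proof
  let ?f = "\<lambda>(i, j). (p i - p j) * (of_bool ((j, i) \<in> r) - of_bool ((i, j) \<in> r))"
  let ?g = "\<lambda>(i, j). \<bar>p i - p j\<bar>"
  let ?S = "{1..n} \<times> {1..n}"
  have L: "?L = sum ?f ?S" and R: "?R = sum ?g ?S"
    unfolding sum_rank_vec_symmetrised sum.cartesian_product by simp_all
  show "\<forall>(i, j)\<in>r. p i \<le> p j" if "?L = ?R"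
  proof (rule ccontr)
    assume "\<not> (\<forall>(i, j)\<in>r. p i \<le> p j)"
    then obtain i j where ij: "(i, j) \<in> r" "p i > p j" by auto
    have "sum ?f ?S < sum ?g ?S"
    proof (rule sum_strict_mono_ex1)
      show "\<forall>x\<in>?S. ?f x \<le> ?g x" by auto
      \<comment> \<open>At the violating pair the difference of indicators is 0 or -1 while
        \<open>p i - p j\<close> is positive, so \<open>?f\<close> is at most 0 and
        \<open>?g\<close> is positive.\<close>
      show "\<exists>x\<in>?S. ?f x < ?g x"
        using ij total_preordersD(1)[OF r] by (intro bexI[of _ "(i, j)"]) auto
    qed simp
    with that L R show False by simp
  qed
  show "?L = ?R" if le: "\<forall>(i, j)\<in>r. p i \<le> p j"
    unfolding L R
  proof (rule sum.cong, safe)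
    fix i j assume "i \<in> {1..n}" "j \<in> {1..n}"
    \<comment> \<open>Totality enters here: if only one direction holds, the factor is 1 or -1 with
      the sign that yields the absolute value; if both hold, \<open>p i = p j\<close> and both sides
      vanish.\<close>
    then have "(i, j) \<in> r \<or> (j, i) \<in> r" by (rule total_preordersD(2)[OF r])
    moreover have "(i, j) \<in> r \<Longrightarrow> p i \<le> p j" "(j, i) \<in> r \<Longrightarrow> p j \<le> p i"
      using le by auto
    ultimately show "(p i - p j) * (of_bool ((j, i) \<in> r) - of_bool ((i, j) \<in> r)) = \<bar>p i - p j\<bar>"
      by (cases "(i, j) \<in> r"; cases "(j, i) \<in> r") auto
  qed
qed

lemma finite_outcomes: "finite (outcomes n)"
  unfolding outcomes_def by (intro finite_PiE) auto

lemma outcomes_cases: "y \<in> outcomes n \<Longrightarrow> i \<in> {1..n} \<Longrightarrow> y i = 0 \<or> y i = 1"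
  by (auto simp: outcomes_def PiE_iff)

lemma expectation_outcome:
  assumes "P \<in> outcome_distributions n" "i \<in> {1..n}"
  shows "measure_pmf.expectation P (\<lambda>y. real (y i)) = measure_pmf.prob P {y. y i = 1}"
proof -
  have "measure_pmf.expectation P (\<lambda>y. real (y i)) =
        measure_pmf.expectation P (indicator {y. y i = 1})"
    using assms
    by (intro integral_cong_AE)
      (auto simp: AE_measure_pmf_iff outcome_distributions_def indicator_def
            dest!: outcomes_cases)
  then show ?thesis by simp
qed

text \<open>Since \<open>n1\<close> is constant on the support, the denominator of the weights
  leaves the expectation, and what remains is linear in \<open>y\<close>.\<close>

lemma expectation_AUC:
  assumes P: "P \<in> outcome_distributions n"
    and k: "\<And>y. y \<in> set_pmf P \<Longrightarrow> n1 n y = k"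
  shows "measure_pmf.expectation P (\<lambda>y. AUC n y r) =
    1/2 + (if k \<in> {0, n} then 0 else 1 / (real (n - k) * real k)) / 2 *
      (\<Sum>i=1..n. measure_pmf.prob P {y. y i = 1} * rank_vec n r i)"
proof -
  define c where "c = (if k \<in> {0, n} then 0 else 1 / (real (n - k) * real k))"
  \<comment> \<open>The support is finite, so linearity of the expectation applies without further
    conditions.\<close>
  have int: "integrable (measure_pmf P) f" for f :: "_ \<Rightarrow> real"
    using P finite_subset[OF _ finite_outcomes]
    by (intro integrable_measure_pmf_finite) (auto simp: outcome_distributions_def)
  have "measure_pmf.expectation P (\<lambda>y. AUC n y r) =
        measure_pmf.expectation P (\<lambda>y. 1/2 + c / 2 * (\<Sum>i=1..n. real (y i) * rank_vec n r i))"
    by (intro integral_cong_AE)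
      (auto simp: AE_measure_pmf_iff k AUC_def auc_weight_def n0_def c_def sum_distrib_left
            intro!: sum.cong)
  also have "\<dots> = 1/2 + c / 2 *
      (\<Sum>i=1..n. measure_pmf.expectation P (\<lambda>y. real (y i)) * rank_vec n r i)"
    by (simp add: int)
  finally show ?thesis
    using P by (simp add: c_def expectation_outcome)
qed

text \<open>A sum of \<open>n\<close> terms from {0, 1} is 0 only if all terms are 0, and
  \<open>n\<close> only if all are 1.\<close>

lemma outcome_constant_extreme:
  assumes "y \<in> outcomes n" "n1 n y \<in> {0, n}" "i \<in> {1..n}"
  shows "y i = 1 \<longleftrightarrow> n1 n y \<noteq> 0"
proof (cases "n1 n y = 0")
  case True
  with assms show ?thesis by (auto simp: n1_def)
next
  case False
  have "y i = 1"
  proof (rule ccontr)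
    assume "y i \<noteq> 1"
    then have "y i < 1" using outcomes_cases assms(1,3) by force
    moreover have "\<forall>j\<in>{1..n}. y j \<le> 1" using outcomes_cases[OF assms(1)] by force
    ultimately have "(\<Sum>j=1..n. y j) < (\<Sum>j=1..n. 1)"
      using assms(3) by (intro sum_strict_mono_ex1) auto
    with assms(2) False show False by (simp add: n1_def)
  qed
  with False show ?thesis by simp
qed

text \<open>All marginal probabilities are 0 or all are 1, so \<open>R_order\<close> relates every
  pair. This settles the equality clause in the case where the expected AUC is the same for all
  preorders.\<close>

lemma R_star_eq_total_preorders:
  assumes P: "P \<in> outcome_distributions n"
    and k: "\<And>y. y \<in> set_pmf P \<Longrightarrow> n1 n y = k" "k \<in> {0, n}"
  shows "R_star n P = total_preorders n"
proof -
  have "measure_pmf.prob P {y. y i = 1} = of_bool (k \<noteq> 0)" if "i \<in> {1..n}" for i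
  proof -
    have "measure_pmf.prob P {y. y i = 1} = measure_pmf.prob P {y. k \<noteq> 0}"
      using P k that outcome_constant_extreme
      by (intro measure_pmf.finite_measure_eq_AE)
        (auto simp: AE_measure_pmf_iff outcome_distributions_def subset_iff)
    then show ?thesis by simp
  qed
  then show ?thesis
    using total_preordersD(1) by (fastforce simp: R_star_def R_order_def)
qed

theorem theorem4:
  fixes n :: nat and F :: "(nat \<Rightarrow> nat) pmf set"
  assumes "n \<ge> 1"
    and "F \<subseteq> outcome_distributions n"
    and "\<And>P. P \<in> F \<Longrightarrow> \<exists>k. AE y in measure_pmf P. n1 n y = k"
  shows "strictly_R_star_proper n (AUC n) F"
  unfolding strictly_R_star_proper_def
proof (intro ballI)
  fix P u t
  assume "P \<in> F" and u: "u \<in> total_preorders n" and t: "t \<in> R_star n P"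
  then have P: "P \<in> outcome_distributions n" using assms(2) by auto
  obtain k where k: "\<And>y. y \<in> set_pmf P \<Longrightarrow> n1 n y = k"
    using assms(3)[OF \<open>P \<in> F\<close>] by (auto simp: AE_measure_pmf_iff)
  define p where "p i = measure_pmf.prob P {y. y i = 1}" for i
  have R_star_iff: "r \<in> R_star n P \<longleftrightarrow> (\<forall>(i, j)\<in>r. p i \<le> p j)"
    if "r \<in> total_preorders n" for r
    using that total_preordersD(1)[OF that] by (auto simp: R_star_def R_order_def p_def)
  have "t \<in> total_preorders n" using t by (simp add: R_star_def)
  then have t_max: "2 * (\<Sum>i=1..n. p i * rank_vec n t i) = (\<Sum>i=1..n. \<Sum>j=1..n. \<bar>p i - p j\<bar>)"
    using t R_star_iff sum_rank_vec_eq_iff by blast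
  define S where "S r = (\<Sum>i=1..n. p i * rank_vec n r i)" for r
  have le: "S u \<le> S t"
    using sum_rank_vec_le[of p n u] t_max by (simp add: S_def)
  have eq: "u \<in> R_star n P" if "S u = S t"
    using that t_max sum_rank_vec_eq_iff[OF u, of p] R_star_iff[OF u] by (simp add: S_def)
  show "measure_pmf.expectation P (\<lambda>y. AUC n y u) \<le> measure_pmf.expectation P (\<lambda>y. AUC n y t) \<and>
    (measure_pmf.expectation P (\<lambda>y. AUC n y u) = measure_pmf.expectation P (\<lambda>y. AUC n y t)
      \<longrightarrow> u \<in> R_star n P)"
  proof (cases "k \<in> {0, n}")
    case True
    then show ?thesis
      using u R_star_eq_total_preorders[OF P k True] by (simp add: expectation_AUC[OF P k])
  next
    case False
    \<comment> \<open>A point of the support witnesses \<open>k \<le> n\<close>; with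
      \<open>k\<close> outside {0, n} this gives \<open>k < n\<close>, so \<open>n - k\<close> does
      not truncate to 0 and \<open>c\<close> is positive.\<close>
    obtain y where y: "y \<in> set_pmf P" using set_pmf_not_empty by fast
    then have "\<forall>i\<in>{1..n}. y i \<le> 1"
      using P outcomes_cases by (fastforce simp: outcome_distributions_def)
    then have "n1 n y \<le> (\<Sum>i=1..n. 1)" unfolding n1_def by (intro sum_mono) auto
    with k[OF y] False have "k < n" "k > 0" by auto
    define c where "c = 1 / (real (n - k) * real k)"
    have c: "c > 0" using \<open>k < n\<close> \<open>k > 0\<close> by (simp add: c_def)
    have E: "measure_pmf.expectation P (\<lambda>y. AUC n y r) = 1/2 + c / 2 * S r" for r
      using False by (simp add: expectation_AUC[OF P k] c_def S_def p_def)
    show ?thesis unfolding E using c le eq by simp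
  qed
qed

end
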